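(* Let $X_i=\varphi\circ f^i_\omega$, $i\ge0$, be the (possibly non-stationary) stochastic process on $(X,\mu^\omega)$ based on the action of the fiber maps $f_\omega^n$, with boundary levels $u_{n,i}=u_n$ for all $i$, as described in the context. Assume that, for some $\tau>0$ (the same as in the definition of $u_n$), for $P$-a.e. $\omega\in\Omega$, $$\bar F_{n,\max}=\max\{\bar F_i(u_n):0\le i\le n-1\}\to0\quad\text{and}\quad F_n^*=\sum_{i=0}^{n-1}\bar F_i(u_n)\to\tau\qquad(n\to\infty).$$ Assume that there exists $q\in\mathbb N_0$ such that, for $P$-a.e. $\omega$, $q=\min\{j\in\mathbb N_0:\lim_{n\to\infty}\min_{i\le n}R^{(j)}_{n,i}=\infty\}$; that for $P$-a.e. $\omega$ conditions $D_q(u_{n,i})$ and $D_q'(u_{n,i})$ are satisfied; and that there is $0\le\theta\le1$ such that, for $P$-a.e. $\omega$ (with $(k_n)$ and blocks as in $D'_q(u_{n,i})$), $$\lim_{n\to\infty}\max_{i=1,\ldots,k_n}\left|\theta k_n\sum_{j=\mathcal L_{n,i-1}}^{\mathcal L_{n,i}-1}\bar F_j(u_n)-k_n\sum_{j=\mathcal L_{n,i-1}}^{\mathcal L_{n,i}-1}\mu^\omega\big(A^{(q)}_{n,j}\big)\right|=0.$$ Then $$\lim_{n\to\infty}\mu^\omega\big(\max\{X_0,\ldots,X_{n-1}\}\le u_n\big)=e^{-\theta\tau}\qquad\text{for }P\text{-a.e. }\omega\in\Omega.$$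
   Context: Random system. $(\Omega,\mathcal G,P)$ is a probability space with an invertible $P$-preserving transformation $\vartheta:\Omega\to\Omega$; $X$ is a metric space (all fibers equal $X$) and $f_\omega:X\to X$, $\omega\in\Omega$, are measurable fiber maps such that the skew map $s(x,\omega)=(f_\omega x,\vartheta\omega)$ is measurable. $f^n_\omega=f_{\vartheta^{n-1}\omega}\circ\cdots\circ f_\omega$, $f^0_\omega=\mathrm{id}$. $\tilde\mu$ is an $s$-invariant probability measure with marginal $P$ on $\Omega$, disintegrated with respect to $P$ into conditional (sample) measures $\mu^\omega$ on $X$ satisfying $(f_\omega)_*\mu^\omega=\mu^{\vartheta\omega}$. The marginal measure on $X$ is $\mu(A)=\int_\Omega\mu^\omega(A)\,dP(\omega)$. Observable: $\varphi(x)=g(\mathrm{dist}(x,\zeta))$ for a chosen $\zeta\in X$, where $g:[0,+\infty)\to\mathbb R\cup\{+\infty\}$ has a global maximum at $0$ ($g(0)=+\infty$ allowed), $g:V\to W$ is a strictly decreasing bijection on a neighbourhood $V$ of $0$, and $g$ is of one of the types: (1) there is a strictly positive $\pi:W\to\mathbb R$ with $\lim_{s\to g(0)}g^{-1}(s+y\pi(s))/g^{-1}(s)=e^{-y}$ for all $y\in\mathbb R$; (2) $g(0)=+\infty$ and there is $b>0$ with $\lim_{s\to+\infty}g^{-1}(sy)/g^{-1}(s)=y^{-b}$ for all $y>0$; (3) $g(0)=D<+\infty$ and there is $a>0$ with $\lim_{s\to0}g^{-1}(D-sy)/g^{-1}(D-s)=y^a$ for all $y>0$. Process and levels. For fixed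 $\omega$, $X_i=\varphi\circ f_\omega^i$ on $(X,\mu^\omega)$; its distribution function is $F_i(u)=\mu^{\vartheta^i\omega}(\{x:\varphi(x)\le u\})$, and $\bar F_i=1-F_i$. With $u_{F_i}=\sup\{x:F_i(x)<1\}$, it is assumed that $\lim_{h\downarrow0}F_i(u_{F_i}-h)=1$ for all $i$. The levels are $u_{n,i}=u_n:=\inf\{u\in\mathbb R:\mu(\{x\in X:\varphi(x)\le u\})\ge1-\tau/n\}$ for all $i$. Events (for fixed $\omega$). For $j\in\mathbb N$, $A^{(j)}_{n,i}=\{X_i>u_n,X_{i+1}\le u_n,\ldots,X_{i+j}\le u_n\}$, and $A^{(0)}_{n,i}=\{X_i>u_n\}$; $\mathbb A^{(j)}_n=(A^{(j)}_{n,0},A^{(j)}_{n,1},\ldots)$. For events $\mathbb A=(A_0,A_1,\ldots)$, $\mathscr W_{s,\ell}(\mathbb A)=\bigcap_{i=s}^{s+\ell-1}A_i^c$. $R^{(j)}_{n,i}=\min\{r\in\mathbb N:A^{(j)}_{n,i}\cap A^{(j)}_{n,i+r}\neq\emptyset\}$ (with $\min\emptyset=\infty$). Condition $D_q(u_{n,i})$ (for fixed $\omega$): for every $\ell,t,n\in\mathbb N$ and $i\in\mathbb N_0$, $$|\mu^\omega(A^{(q)}_{n,i}\cap\mathscr W_{i+t,\ell}(\mathbb A_n^{(q)}))-\mu^\omega(A^{(q)}_{n,i})\mu^\omega(\mathscr W_{i+t,\ell}(\mathbb A^{(q)}_n))|\le\gamma_i(q,n,t),$$ where $\gamma_i(q,n,t)$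 is decreasing in $t$ for each $n,i$, and there is a sequence $(t^*_n)$ of positive integers with $t_n^*\bar F_{n,\max}\to0$ and $\sum_{i=0}^{n-1}\gamma_i(q,n,t_n^* )\to0$. Blocks: given positive integers $k_n$ with $k_n\to\infty$ and $k_nt_n^*\bar F_{n,\max}\to0$, set $\mathcal L_{n,0}=0$, $\mathcal L_{n,i}=\sum_{j=1}^i\ell_{n,j}$, where inductively $\ell_{n,i}$, $1\le i\le k_n$, is the largest integer (with $\mathcal L_{n,i-1}+\ell_{n,i}\le n$) such that $\sum_{j=\mathcal L_{n,i-1}}^{\mathcal L_{n,i-1}+\ell_{n,i}-1}\bar F_j(u_n)\le F_n^*/k_n$. Condition $D'_q(u_{n,i})$ (for fixed $\omega$): there is a sequence $(k_n)$ of positive integers with $k_n\to\infty$ and $k_nt_n^*\bar F_{n,\max}\to0$, where $(t_n^* )$ is the sequence from $D_q(u_{n,i})$, such that, for the block lengths $\ell_{n,i}$ and endpoints $\mathcal L_{n,i}$ constructed from this $(k_n)$ (that is, $\mathcal L_{n,0}=0$, $\mathcal L_{n,i}=\sum_{j=1}^i\ell_{n,j}$, and $\ell_{n,i}$ is the largest integer with $\mathcal L_{n,i-1}+\ell_{n,i}\le n$ and $\sum_{j=\mathcal L_{n,i-1}}^{\mathcal L_{n,i-1}+\ell_{n,i}-1}\bar F_j(u_n)\le F_n^*/k_n$), $$\lim_{n\to\infty}\sum_{i=1}^{k_n}\sum_{j=0}^{\ell_{n,i}-1}\sum_{r=j+1}^{\ell_{n,i}-1}\mu^\omega\big(A^{(q)}_{n,\mathcal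 L_{n,i-1}+j}\cap A^{(q)}_{n,\mathcal L_{n,i-1}+r}\big)=0.$$ *)

theory Defs
  imports "HOL-Probability.Probability"
begin

text \<open>
  Random systems. The fibres are all equal to a metric space (the type \<open>'x\<close>, with its Borel
  sets), and the base is a probability space \<open>P\<close>. \<open>\<mu>t\<close> is the invariant measure of the skew map
  and \<open>\<mu> \<omega>\<close> are its sample measures. Equivariance of the sample measures is only required almost
  everywhere, and \<open>T\<close> is not assumed to have a measurable inverse.
\<close>

locale random_system = prob_space P
  for P :: "'w measure" +
  fixes T :: "'w \<Rightarrow> 'w"
    and f :: "'w \<Rightarrow> 'x::metric_space \<Rightarrow> 'x"
    and \<mu>t :: "('x \<times> 'w) measure"
    and \<mu> :: "'w \<Rightarrow> 'x measure"
  assumes base_measurable: "T \<in> P \<rightarrow>\<^sub>M P"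
    and base_invertible: "bij_betw T (space P) (space P)"
    and base_preserving: "distr P P T = P"
    and fiber_measurable: "\<And>\<omega>. \<omega> \<in> space P \<Longrightarrow> f \<omega> \<in> borel \<rightarrow>\<^sub>M borel"
    and skew_measurable: "(\<lambda>(x, \<omega>). (f \<omega> x, T \<omega>)) \<in> borel \<Otimes>\<^sub>M P \<rightarrow>\<^sub>M borel \<Otimes>\<^sub>M P"
    and total_prob: "prob_space \<mu>t"
    and total_sets: "sets \<mu>t = sets (borel \<Otimes>\<^sub>M P)"
    and total_invariant: "distr \<mu>t (borel \<Otimes>\<^sub>M P) (\<lambda>(x, \<omega>). (f \<omega> x, T \<omega>)) = \<mu>t"
    and total_marginal: "distr \<mu>t P snd = P"
    and sample_kernel: "\<mu> \<in> P \<rightarrow>\<^sub>M prob_algebra borel"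
    and disintegration: "\<And>E. E \<in> sets (borel \<Otimes>\<^sub>M P) \<Longrightarrow>
          emeasure \<mu>t E = (\<integral>\<^sup>+\<omega>. emeasure (\<mu> \<omega>) {x. (x, \<omega>) \<in> E} \<partial>P)"
    and sample_equivariant: "AE \<omega> in P. distr (\<mu> \<omega>) borel (f \<omega>) = \<mu> (T \<omega>)"

definition marginal :: "'w measure \<Rightarrow> ('w \<Rightarrow> 'x measure) \<Rightarrow> 'x set \<Rightarrow> real" where
  "marginal P \<mu> A = (\<integral>\<omega>. measure (\<mu> \<omega>) A \<partial>P)"

primrec fiber_iter :: "('w \<Rightarrow> 'w) \<Rightarrow> ('w \<Rightarrow> 'x \<Rightarrow> 'x) \<Rightarrow> 'w \<Rightarrow> nat \<Rightarrow> 'x \<Rightarrow> 'x" where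
  "fiber_iter T f \<omega> 0 = id"
| "fiber_iter T f \<omega> (Suc n) = f ((T ^^ n) \<omega>) \<circ> fiber_iter T f \<omega> n"

text \<open>
  The three types of behaviour of a profile at its maximum. \<open>M\<close> is the maximal value \<open>g 0\<close>,
  \<open>h\<close> the inverse of the bijection \<open>g : V \<rightarrow> W\<close>. The limit \<open>s \<rightarrow> g 0\<close> is necessarily from
  the left, and in the first type the argument of the inverse has to lie in its domain \<open>W\<close>
  for the limit to be meaningful.
\<close>

definition profile_type1 :: "ereal \<Rightarrow> ereal set \<Rightarrow> (ereal \<Rightarrow> real) \<Rightarrow> bool" where
  "profile_type1 M W h \<longleftrightarrow>
     (\<exists>\<pi> :: ereal \<Rightarrow> real. (\<forall>s\<in>W. \<pi> s > 0) \<and>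
       (\<forall>y::real. (\<forall>\<^sub>F s in at_left M. s + ereal (y * \<pi> s) \<in> W) \<and>
          ((\<lambda>s. h (s + ereal (y * \<pi> s)) / h s) \<longlongrightarrow> exp (- y)) (at_left M)))"

definition profile_type2 :: "ereal \<Rightarrow> (ereal \<Rightarrow> real) \<Rightarrow> bool" where
  "profile_type2 M h \<longleftrightarrow> M = \<infinity> \<and>
     (\<exists>b>0. \<forall>y::real>0.
        ((\<lambda>s::real. h (ereal (s * y)) / h (ereal s)) \<longlongrightarrow> y powr (- b)) at_top)"

definition profile_type3 :: "ereal \<Rightarrow> (ereal \<Rightarrow> real) \<Rightarrow> bool" where
  "profile_type3 M h \<longleftrightarrow>
     (\<exists>D::real. M = ereal D \<and>
       (\<exists>a>0. \<forall>y::real>0.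
          ((\<lambda>s::real. h (ereal (D - s * y)) / h (ereal (D - s))) \<longlongrightarrow> y powr a) (at_right 0)))"

text \<open>
  Only the values of \<open>g\<close> on \<open>[0, \<infinity>)\<close> matter. That \<open>W\<close> contains all values slightly below
  \<open>g 0\<close> is what makes the limits above well defined.
\<close>

definition admissible_profile :: "(real \<Rightarrow> ereal) \<Rightarrow> bool" where
  "admissible_profile g \<longleftrightarrow>
     (\<forall>r\<ge>0. g r \<noteq> - \<infinity> \<and> g r \<le> g 0) \<and>
     (\<exists>V W. V \<subseteq> {0..} \<and> (\<exists>\<epsilon>>0. {0..<\<epsilon>} \<subseteq> V) \<and>
        bij_betw g V W \<and> strict_antimono_on V g \<and>
        (\<forall>\<^sub>F s in at_left (g 0). s \<in> W) \<and>
        (profile_type1 (g 0) W (inv_into V g) \<or>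
         profile_type2 (g 0) (inv_into V g) \<or>
         profile_type3 (g 0) (inv_into V g)))"

definition obs :: "(real \<Rightarrow> ereal) \<Rightarrow> 'x::metric_space \<Rightarrow> 'x \<Rightarrow> ereal" where
  "obs g \<zeta> x = g (dist x \<zeta>)"

definition process ::
  "('w \<Rightarrow> 'w) \<Rightarrow> ('w \<Rightarrow> 'x \<Rightarrow> 'x) \<Rightarrow> ('x \<Rightarrow> ereal) \<Rightarrow> 'w \<Rightarrow> nat \<Rightarrow> 'x \<Rightarrow> ereal" where
  "process T f \<phi> \<omega> i = \<phi> \<circ> fiber_iter T f \<omega> i"

definition dist_fun ::
  "('w \<Rightarrow> 'w) \<Rightarrow> ('w \<Rightarrow> 'x measure) \<Rightarrow> ('x \<Rightarrow> ereal) \<Rightarrow> 'w \<Rightarrow> nat \<Rightarrow> ereal \<Rightarrow> real" where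
  "dist_fun T \<mu> \<phi> \<omega> i u = measure (\<mu> ((T ^^ i) \<omega>)) {x. \<phi> x \<le> u}"

definition right_endpoint :: "(ereal \<Rightarrow> real) \<Rightarrow> ereal" where
  "right_endpoint F = Sup {ereal x | x. F (ereal x) < 1}"

text \<open>
  The infimum is over real \<open>u\<close> but is taken in the extended reals: the set is all of the reals
  when \<open>n \<le> \<tau>\<close>, and it may be empty if \<open>\<phi>\<close> is infinite with positive probability.
\<close>

definition level ::
  "'w measure \<Rightarrow> ('w \<Rightarrow> 'x measure) \<Rightarrow> ('x \<Rightarrow> ereal) \<Rightarrow> real \<Rightarrow> nat \<Rightarrow> ereal" where
  "level P \<mu> \<phi> \<tau> n =
     Inf {ereal u | u. marginal P \<mu> {x. \<phi> x \<le> ereal u} \<ge> 1 - \<tau> / real n}"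

definition tail ::
  "('w \<Rightarrow> 'w) \<Rightarrow> ('w \<Rightarrow> 'x measure) \<Rightarrow> ('x \<Rightarrow> ereal) \<Rightarrow> (nat \<Rightarrow> ereal) \<Rightarrow> 'w \<Rightarrow> nat \<Rightarrow> nat \<Rightarrow> real"
  where "tail T \<mu> \<phi> u \<omega> n i = 1 - dist_fun T \<mu> \<phi> \<omega> i (u n)"

text \<open>
  From here on \<open>\<omega>\<close> is fixed: \<open>m\<close> is its sample measure, \<open>X\<close> the process, \<open>u n\<close> the level,
  and \<open>G n i\<close> stands for the tail \<open>1 - F\<^sub>i(u\<^sub>n)\<close>. Quantities that only matter in the limit
  are left unspecified at \<open>n = 0\<close>.
\<close>

definition tail_max :: "(nat \<Rightarrow> nat \<Rightarrow> real) \<Rightarrow> nat \<Rightarrow> real" where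
  "tail_max G n = (MAX i\<in>{..<n}. G n i)"

definition tail_sum :: "(nat \<Rightarrow> nat \<Rightarrow> real) \<Rightarrow> nat \<Rightarrow> real" where
  "tail_sum G n = (\<Sum>i<n. G n i)"

definition event :: "(nat \<Rightarrow> 'x \<Rightarrow> ereal) \<Rightarrow> (nat \<Rightarrow> ereal) \<Rightarrow> nat \<Rightarrow> nat \<Rightarrow> nat \<Rightarrow> 'x set" where
  "event X u j n i = {x. X i x > u n \<and> (\<forall>k\<in>{1..j}. X (i + k) x \<le> u n)}"

definition avoid :: "(nat \<Rightarrow> 'x set) \<Rightarrow> nat \<Rightarrow> nat \<Rightarrow> 'x set" where
  "avoid A s l = (\<Inter>i\<in>{s..<s + l}. - A i)"

definition return_time :: "(nat \<Rightarrow> 'x \<Rightarrow> ereal) \<Rightarrow> (nat \<Rightarrow> ereal) \<Rightarrow> nat \<Rightarrow> nat \<Rightarrow> nat \<Rightarrow> enat" where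
  "return_time X u j n i =
     Inf {enat r | r. r \<ge> 1 \<and> event X u j n i \<inter> event X u j n (i + r) \<noteq> {}}"

definition returns_diverge :: "(nat \<Rightarrow> 'x \<Rightarrow> ereal) \<Rightarrow> (nat \<Rightarrow> ereal) \<Rightarrow> nat \<Rightarrow> bool" where
  "returns_diverge X u j \<longleftrightarrow> ((\<lambda>n. MIN i\<in>{..n}. return_time X u j n i) \<longlonglongrightarrow> \<infinity>)"

definition cond_D ::
  "'x measure \<Rightarrow> (nat \<Rightarrow> 'x \<Rightarrow> ereal) \<Rightarrow> (nat \<Rightarrow> ereal) \<Rightarrow> (nat \<Rightarrow> nat \<Rightarrow> real) \<Rightarrow> nat
    \<Rightarrow> (nat \<Rightarrow> nat \<Rightarrow> nat \<Rightarrow> real) \<Rightarrow> (nat \<Rightarrow> nat) \<Rightarrow> bool" where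
  "cond_D m X u G q \<gamma> t \<longleftrightarrow>
     (\<forall>l\<ge>1. \<forall>s\<ge>1. \<forall>n\<ge>1. \<forall>i.
        \<bar>measure m (event X u q n i \<inter> avoid (event X u q n) (i + s) l)
          - measure m (event X u q n i) * measure m (avoid (event X u q n) (i + s) l)\<bar>
        \<le> \<gamma> i n s) \<and>
     (\<forall>n\<ge>1. \<forall>i. antimono_on {1..} (\<gamma> i n)) \<and>
     (\<forall>n. t n > 0) \<and>
     (\<lambda>n. real (t n) * tail_max G n) \<longlonglongrightarrow> 0 \<and>
     (\<lambda>n. \<Sum>i<n. \<gamma> i n (t n)) \<longlonglongrightarrow> 0"

text \<open>The length of the block that starts at \<open>L\<close>; the maximum is over a finite set containing \<open>0\<close>.\<close>

definition next_len :: "(nat \<Rightarrow> nat \<Rightarrow> real) \<Rightarrow> (nat \<Rightarrow> nat) \<Rightarrow> nat \<Rightarrow> nat \<Rightarrow> nat" where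
  "next_len G k n L =
     Max {l. L + l \<le> n \<and> (\<Sum>j\<in>{L..<L + l}. G n j) \<le> tail_sum G n / real (k n)}"

primrec block_end :: "(nat \<Rightarrow> nat \<Rightarrow> real) \<Rightarrow> (nat \<Rightarrow> nat) \<Rightarrow> nat \<Rightarrow> nat \<Rightarrow> nat" where
  "block_end G k n 0 = 0"
| "block_end G k n (Suc i) = block_end G k n i + next_len G k n (block_end G k n i)"

definition block_len :: "(nat \<Rightarrow> nat \<Rightarrow> real) \<Rightarrow> (nat \<Rightarrow> nat) \<Rightarrow> nat \<Rightarrow> nat \<Rightarrow> nat" where
  "block_len G k n i = next_len G k n (block_end G k n (i - 1))"

definition cond_D' ::
  "'x measure \<Rightarrow> (nat \<Rightarrow> 'x \<Rightarrow> ereal) \<Rightarrow> (nat \<Rightarrow> ereal) \<Rightarrow> (nat \<Rightarrow> nat \<Rightarrow> real) \<Rightarrow> nat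
    \<Rightarrow> (nat \<Rightarrow> nat) \<Rightarrow> (nat \<Rightarrow> nat) \<Rightarrow> bool" where
  "cond_D' m X u G q t k \<longleftrightarrow>
     (\<forall>n. k n > 0) \<and>
     filterlim k at_top sequentially \<and>
     (\<lambda>n. real (k n) * real (t n) * tail_max G n) \<longlonglongrightarrow> 0 \<and>
     (\<lambda>n. \<Sum>i\<in>{1..k n}. \<Sum>j<block_len G k n i. \<Sum>r\<in>{j + 1..<block_len G k n i}.
        measure m (event X u q n (block_end G k n (i - 1) + j)
                   \<inter> event X u q n (block_end G k n (i - 1) + r))) \<longlonglongrightarrow> 0"

definition extremal_index_cond ::
  "'x measure \<Rightarrow> (nat \<Rightarrow> 'x \<Rightarrow> ereal) \<Rightarrow> (nat \<Rightarrow> ereal) \<Rightarrow> (nat \<Rightarrow> nat \<Rightarrow> real) \<Rightarrow> nat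
    \<Rightarrow> (nat \<Rightarrow> nat) \<Rightarrow> real \<Rightarrow> bool" where
  "extremal_index_cond m X u G q k \<theta> \<longleftrightarrow>
     (\<lambda>n. MAX i\<in>{1..k n}.
        \<bar>\<theta> * real (k n) * (\<Sum>j\<in>{block_end G k n (i - 1)..<block_end G k n i}. G n j)
         - real (k n) * (\<Sum>j\<in>{block_end G k n (i - 1)..<block_end G k n i}.
                            measure m (event X u q n j))\<bar>) \<longlonglongrightarrow> 0"

end

theory Submission
  imports Defs
begin

text \<open>
  For fixed \<open>\<omega>\<close>, equivariance along the orbit identifies the tails \<open>1 - F\<^sub>i(u\<^sub>n)\<close> with the
  probabilities of exceeding \<open>u\<^sub>n\<close> under \<open>\<mu>\<^sup>\<omega>\<close>, and having no exceedance before time \<open>n\<close> differs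
  from avoiding all the events \<open>A\<^sub>j\<close> of order \<open>q\<close> only through the last \<open>q\<close> indices.
  Let \<open>V\<^sub>i\<close> be the probability of avoiding the \<open>A\<^sub>j\<close> from the end of the \<open>i\<close>-th block up to \<open>n\<close>, and
  \<open>a\<^sub>i\<close> the sum of the \<open>\<mu>\<^sup>\<omega>(A\<^sub>j)\<close> over the next block. A Bonferroni inequality inside that block and mixing
  between the block and the future give \<open>V\<^sub>i \<approx> (1 - a\<^sub>i) V\<^sub>i\<^sub>+\<^sub>1\<close>, with errors that sum to \<open>0\<close> in the
  limit. The blocks exhaust almost all of the tail sum, so the last \<open>V\<^sub>i\<close> tends to \<open>1\<close> and \<open>V\<^sub>0\<close> is
  asymptotic to the product of the \<open>1 - a\<^sub>i\<close>; since the \<open>a\<^sub>i\<close> are uniformly small and sum to \<open>\<theta>\<tau>\<close> in the limit, the product tends to \<open>exp (- \<theta>\<tau>)\<close>.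
\<close>

section \<open>Products of factors close to one, and approximate recursions\<close>

text \<open>Each factor differs from \<open>exp (- a n i)\<close> by at most
  \<open>d n * a n i\<close>. All factors have norm at most one, so these errors add up, to
  \<open>d n\<close> times a convergent sum.\<close>

lemma prod_one_minus_tendsto_exp:
  fixes a :: "nat \<Rightarrow> nat \<Rightarrow> real"
  assumes bounds: "\<forall>\<^sub>F n in sequentially. \<forall>i<k n. 0 \<le> a n i \<and> a n i \<le> d n"
    and d: "d \<longlonglongrightarrow> 0"
    and sum: "(\<lambda>n. \<Sum>i<k n. a n i) \<longlonglongrightarrow> s"
  shows "(\<lambda>n. \<Prod>i<k n. 1 - a n i) \<longlonglongrightarrow> exp (- s)"
proof -
  have quad: "\<bar>(1 - x) - exp (- x)\<bar> \<le> x\<^sup>2" if "0 \<le> x" for x :: real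
  proof -
    have "exp (- x) * (1 + x) \<le> exp (- x) * exp x"
      by (intro mult_left_mono exp_ge_add_one_self) simp
    also have "\<dots> = 1"
      by (simp flip: exp_add)
    \<comment> \<open>The right-hand side equals 1 + x^3; cancelling 1 + x bounds
      \<open>exp (- x)\<close> from above.\<close>
    also have "1 \<le> (1 - x + x\<^sup>2) * (1 + x)"
      using that by (simp add: algebra_simps power2_eq_square)
    finally have "exp (- x) \<le> 1 - x + x\<^sup>2"
      using that by simp
    then show ?thesis
      using exp_ge_add_one_self[of "- x"] by linarith
  qed
  have lim: "(\<lambda>n. d n * (\<Sum>i<k n. a n i)) \<longlonglongrightarrow> 0"
    using tendsto_mult[OF d sum] by simp
  \<comment> \<open>Puts every \<open>1 - a n i\<close> in [0, 1], so that
    \<open>norm_prod_diff\<close> applies.\<close>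
  have "\<forall>\<^sub>F n in sequentially. d n < 1"
    using order_tendstoD(2)[OF d, of 1] by simp
  with bounds have "\<forall>\<^sub>F n in sequentially.
      norm ((\<Prod>i<k n. 1 - a n i) - exp (- (\<Sum>i<k n. a n i))) \<le> d n * (\<Sum>i<k n. a n i)"
  proof eventually_elim
    case (elim n)
    have "norm ((\<Prod>i<k n. 1 - a n i) - exp (- (\<Sum>i<k n. a n i)))
        = norm ((\<Prod>i<k n. 1 - a n i) - (\<Prod>i<k n. exp (- a n i)))"
      by (simp add: exp_sum flip: sum_negf)
    also have "\<dots> \<le> (\<Sum>i<k n. norm ((1 - a n i) - exp (- a n i)))"
    proof (rule norm_prod_diff)
      show "norm (1 - a n i) \<le> 1" if "i \<in> {..<k n}" for i
        using elim that by (force simp: abs_le_iff)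
      show "norm (exp (- a n i)) \<le> 1" if "i \<in> {..<k n}" for i
        using elim that by simp
    qed
    also have "\<dots> \<le> (\<Sum>i<k n. d n * a n i)"
    proof (rule sum_mono)
      fix i assume "i \<in> {..<k n}"
      then have "0 \<le> a n i" "a n i \<le> d n"
        using elim by auto
      then have "(a n i)\<^sup>2 \<le> d n * a n i"
        by (simp add: power2_eq_square mult_right_mono)
      then show "norm ((1 - a n i) - exp (- a n i)) \<le> d n * a n i"
        using quad[of "a n i"] \<open>0 \<le> a n i\<close> by simp
    qed
    finally show ?case
      by (simp add: sum_distrib_left)
  qed
  then have "(\<lambda>n. (\<Prod>i<k n. 1 - a n i) - exp (- (\<Sum>i<k n. a n i))) \<longlonglongrightarrow> 0"
    by (rule Lim_null_comparison[OF _ lim])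
  moreover have "(\<lambda>n. exp (- (\<Sum>i<k n. a n i))) \<longlonglongrightarrow> exp (- s)"
    by (intro tendsto_intros sum)
  ultimately show ?thesis
    using tendsto_add by fastforce
qed

text \<open>Unrolling multiplies the error of each step by the earlier factors, which lie in [0, 1],
  so the errors merely add.\<close>

lemma approx_recursion_prod:
  fixes v a e :: "nat \<Rightarrow> real"
  assumes "\<And>i. i < k \<Longrightarrow> 0 \<le> a i \<and> a i \<le> 1"
    and "\<And>i. i < k \<Longrightarrow> \<bar>v i - (1 - a i) * v (Suc i)\<bar> \<le> e i"
  shows "\<bar>v 0 - (\<Prod>i<k. 1 - a i) * v k\<bar> \<le> (\<Sum>i<k. e i)"
  using assms
proof (induction k)
  case (Suc k)
  let ?p = "\<Prod>i<k. 1 - a i"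
  have p: "0 \<le> ?p" "?p \<le> 1"
    using Suc.prems(1) by (auto intro!: prod_nonneg prod_le_1 simp: less_Suc_eq)
  have "\<bar>?p * (v k - (1 - a k) * v (Suc k))\<bar> \<le> 1 * e k"
    unfolding abs_mult using p Suc.prems(2)[of k] by (intro mult_mono) auto
  moreover have "\<bar>v 0 - ?p * v k\<bar> \<le> (\<Sum>i<k. e i)"
    using Suc by simp
  ultimately show ?case
    by (simp add: algebra_simps)
qed simp

section \<open>The greedy block construction\<close>

text \<open>Nonnegative tails make 0 an admissible length, so the maximum is attained. The last
  claim is its maximality: short of \<open>n\<close>, one more index overshoots the budget.\<close>

lemma next_len_props:
  assumes "\<And>j. 0 \<le> G n j" and "L \<le> n"
  shows "L + next_len G k n L \<le> n"
    and "(\<Sum>j\<in>{L..<L + next_len G k n L}. G n j) \<le> tail_sum G n / real (k n)"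
    and "L + next_len G k n L < n \<Longrightarrow>
      tail_sum G n / real (k n) < (\<Sum>j\<in>{L..<L + Suc (next_len G k n L)}. G n j)"
proof -
  let ?S = "{l. L + l \<le> n \<and> (\<Sum>j\<in>{L..<L + l}. G n j) \<le> tail_sum G n / real (k n)}"
  have fin: "finite ?S"
    by (rule finite_subset[of _ "{..n}"]) auto
  have "0 \<in> ?S"
    using assms by (simp add: tail_sum_def sum_nonneg)
  then have "next_len G k n L \<in> ?S"
    unfolding next_len_def using Max_in[OF fin] by blast
  then show "L + next_len G k n L \<le> n"
    and "(\<Sum>j\<in>{L..<L + next_len G k n L}. G n j) \<le> tail_sum G n / real (k n)"
    by auto
  have "Suc (next_len G k n L) \<notin> ?S"
    using Max_ge[OF fin, of "Suc (next_len G k n L)"] unfolding next_len_def by auto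
  then show "tail_sum G n / real (k n) < (\<Sum>j\<in>{L..<L + Suc (next_len G k n L)}. G n j)"
    if "L + next_len G k n L < n"
    using that by auto
qed

lemma block_end_le:
  assumes "\<And>j. 0 \<le> G n j"
  shows "block_end G k n i \<le> n"
  by (induction i) (use assms next_len_props(1)[of G n] in auto)

lemma sum_blocks:
  "(\<Sum>i<m. \<Sum>j\<in>{block_end G k n i..<block_end G k n (Suc i)}. h j)
    = (\<Sum>j<block_end G k n m. h j :: real)"
proof (induction m)
  case (Suc m)
  have "{..<block_end G k n (Suc m)}
      = {..<block_end G k n m} \<union> {block_end G k n m..<block_end G k n (Suc m)}"
    by auto
  then show ?case
    using Suc by (simp add: sum.union_disjoint ivl_disj_int del: block_end.simps(2))
qed simp

lemma tail_le_tail_max: "i < n \<Longrightarrow> G n i \<le> tail_max G n"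
  unfolding tail_max_def by (intro Max_ge) auto

text \<open>A block ending before \<open>n\<close> misses its budget
  \<open>tail_sum G n / real (k n)\<close> by less than the tail of the next index, hence by less
  than \<open>tail_max G n\<close>.\<close>

lemma sum_blocks_ge:
  assumes nonneg: "\<And>j. 0 \<le> G n j" and "0 < k n" and "0 < n"
  shows "tail_sum G n - real (k n) * tail_max G n \<le> (\<Sum>j<block_end G k n (k n). G n j)"
proof -
  let ?L = "block_end G k n"
  \<comment> \<open>Once \<open>n\<close> is reached, all later blocks are empty and may miss their
    budget, but then nothing is left uncovered.\<close>
  have "?L i = n \<or> real i * (tail_sum G n / real (k n) - tail_max G n) \<le> (\<Sum>j<?L i. G n j)" for i
  proof (induction i)
    case (Suc i)
    have "?L i \<le> n"
      using nonneg by (rule block_end_le)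
    note props = next_len_props[where G = G and n = n and k = k, OF nonneg this]
    show ?case
    proof (cases "?L (Suc i) = n")
      case False
      with props(1) have less: "?L (Suc i) < n"
        by simp
      with Suc have "real i * (tail_sum G n / real (k n) - tail_max G n) \<le> (\<Sum>j<?L i. G n j)"
        by auto
      moreover have "tail_sum G n / real (k n) - tail_max G n
          \<le> (\<Sum>j\<in>{?L i..<?L (Suc i)}. G n j)"
        using props(3) less tail_le_tail_max[where G = G, OF less] by simp
      moreover have "(\<Sum>j<?L (Suc i). G n j)
          = (\<Sum>j<?L i. G n j) + (\<Sum>j\<in>{?L i..<?L (Suc i)}. G n j)"
        unfolding sum_blocks[symmetric] by (rule sum.lessThan_Suc)
      ultimately show ?thesis
        unfolding of_nat_Suc distrib_right mult_1 by linarith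
    qed simp
  qed simp
  from this[of "k n"] show ?thesis
  proof
    assume "?L (k n) = n"
    moreover have "0 \<le> tail_max G n"
      using nonneg[of 0] tail_le_tail_max[of 0 n G] \<open>0 < n\<close> by linarith
    ultimately show ?thesis
      by (simp add: tail_sum_def)
  qed (use \<open>0 < k n\<close> in \<open>simp add: algebra_simps\<close>)
qed

text \<open>Passes from the offsets within a block used in \<open>cond_D'\<close> to the absolute
  indices of the Bonferroni error.\<close>

lemma sum_pairs_shift:
  fixes h :: "nat \<Rightarrow> nat \<Rightarrow> real"
  shows "(\<Sum>j<l. \<Sum>r\<in>{j + 1..<l}. h (L + j) (L + r))
    = (\<Sum>j\<in>{L..<L + l}. \<Sum>r\<in>{Suc j..<L + l}. h j r)"
proof -
  have "(\<Sum>r\<in>{j + 1..<l}. h (L + j) (L + r)) = (\<Sum>r\<in>{Suc (L + j)..<L + l}. h (L + j) r)" for j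
    using sum.shift_bounds_nat_ivl[of "h (L + j)" "j + 1" L l] by (simp add: ac_simps)
  then show ?thesis
    using sum.shift_bounds_nat_ivl[of "\<lambda>j. \<Sum>r\<in>{Suc j..<L + l}. h j r" 0 L l]
    by (simp add: ac_simps atLeast0LessThan)
qed

section \<open>Avoiding a sequence of events up to a fixed horizon\<close>

lemma avoid_diff_Suc:
  assumes "s < n"
  shows "avoid A s (n - s) = avoid A (Suc s) (n - Suc s) - A s"
proof -
  have "{s..<s + (n - s)} = insert s {Suc s..<Suc s + (n - Suc s)}"
    using assms by auto
  then show ?thesis
    by (auto simp: avoid_def)
qed

lemma avoid_diff_subset:
  assumes "s \<le> s'" "s' \<le> n"
  shows "avoid A s' (n - s') - avoid A s (n - s) \<subseteq> (\<Union>r\<in>{s..<s'}. A r)"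
  using assms by (auto simp: avoid_def)

lemma avoid_antimono:
  assumes "s \<le> s'" "s' \<le> n"
  shows "avoid A s (n - s) \<subseteq> avoid A s' (n - s')"
  using assms by (auto simp: avoid_def)

context prob_space
begin

context
  fixes A :: "nat \<Rightarrow> 'a set"
  assumes space: "space M = UNIV" and A: "\<And>i. A i \<in> events"
begin

lemma avoid_in_events: "avoid A s l \<in> events"
proof -
  have "avoid A s l = space M - (\<Union>i\<in>{s..<s + l}. A i)"
    by (auto simp: avoid_def space)
  then show ?thesis
    using A by auto
qed

lemma prob_avoid_ge: "1 - (\<Sum>i\<in>{s..<s + l}. prob (A i)) \<le> prob (avoid A s l)"
proof -
  have "avoid A s l = space M - (\<Union>i\<in>{s..<s + l}. A i)"
    by (auto simp: avoid_def space)
  then have "prob (avoid A s l) = 1 - prob (\<Union>i\<in>{s..<s + l}. A i)"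
    using A by (simp add: prob_compl)
  then show ?thesis
    using finite_measure_subadditive_finite[of "{s..<s + l}" A] A by auto
qed

text \<open>Going down from \<open>L'\<close>, prepending an index \<open>L\<close> removes exactly
  \<open>A L\<close> intersected with the later avoidance set. Replacing that set by the fixed
  \<open>V\<close> changes the removed mass by at most the pair probabilities of \<open>A L\<close>
  with the later \<open>A r\<close> of the block.\<close>

lemma avoid_bonferroni:
  assumes "L \<le> L'" "L' \<le> n"
  defines "V \<equiv> avoid A L' (n - L')"
  shows "\<bar>prob (avoid A L (n - L)) - (prob V - (\<Sum>j\<in>{L..<L'}. prob (A j \<inter> V)))\<bar>
    \<le> (\<Sum>j\<in>{L..<L'}. \<Sum>r\<in>{Suc j..<L'}. prob (A j \<inter> A r))"
  using \<open>L \<le> L'\<close>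
proof (induction L rule: inc_induct)
  case base
  then show ?case by (simp add: V_def)
next
  case (step L)
  let ?W = "avoid A (Suc L) (n - Suc L)"
  have V: "V \<in> events"
    by (simp add: V_def avoid_in_events)
  have "prob (avoid A L (n - L)) = prob ?W - prob (A L \<inter> ?W)"
    using avoid_diff_Suc[of L n A] step assms
    by (simp add: finite_measure_Diff' avoid_in_events A Int_commute)
  moreover have "prob (A L \<inter> ?W) \<le> prob (A L \<inter> V)"
    using avoid_antimono[of "Suc L" L' n A] step assms V A
    by (intro finite_measure_mono) auto
  moreover have "prob (A L \<inter> V) \<le> prob (A L \<inter> ?W) + (\<Sum>r\<in>{Suc L..<L'}. prob (A L \<inter> A r))"
  proof -
    have "A L \<inter> V \<subseteq> (A L \<inter> ?W) \<union> (\<Union>r\<in>{Suc L..<L'}. A L \<inter> A r)"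
      using avoid_diff_subset[of "Suc L" L' n A] step assms by auto
    then have "prob (A L \<inter> V) \<le> prob ((A L \<inter> ?W) \<union> (\<Union>r\<in>{Suc L..<L'}. A L \<inter> A r))"
      using A avoid_in_events by (intro finite_measure_mono) auto
    also have "\<dots> \<le> prob (A L \<inter> ?W) + prob (\<Union>r\<in>{Suc L..<L'}. A L \<inter> A r)"
      using A avoid_in_events by (intro measure_Un_le) auto
    also have "\<dots> \<le> prob (A L \<inter> ?W) + (\<Sum>r\<in>{Suc L..<L'}. prob (A L \<inter> A r))"
      using A by (intro add_left_mono finite_measure_subadditive_finite) auto
    finally show ?thesis .
  qed
  ultimately show ?case
    using step.IH unfolding sum.atLeast_Suc_lessThan[OF step.hyps(2)] abs_le_iff by linarith
qed

text \<open>
  The mixing estimate \<open>mix\<close> needs a gap of length \<open>t\<close>; it is lost only for the last \<open>t\<close> indices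
  of the block, each of which costs at most \<open>c\<close>.
\<close>

lemma avoid_block_step:
  fixes \<gamma> :: "nat \<Rightarrow> real"
  assumes "L \<le> L'" "L' \<le> n"
  defines "V \<equiv> avoid A L' (n - L')"
  assumes c: "\<And>j. j < n \<Longrightarrow> prob (A j) \<le> c" "0 \<le> c"
    and \<gamma>: "\<And>j. 0 \<le> \<gamma> j"
    and mix: "\<And>j. j + t \<le> L' \<Longrightarrow> \<bar>prob (A j \<inter> V) - prob (A j) * prob V\<bar> \<le> \<gamma> j"
  shows "\<bar>prob (avoid A L (n - L)) - (1 - (\<Sum>j\<in>{L..<L'}. prob (A j))) * prob V\<bar>
    \<le> (\<Sum>j\<in>{L..<L'}. \<Sum>r\<in>{Suc j..<L'}. prob (A j \<inter> A r)) + (\<Sum>j\<in>{L..<L'}. \<gamma> j) + real t * c"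
proof -
  have V: "V \<in> events"
    by (simp add: V_def avoid_in_events)
  have "\<bar>prob (A j \<inter> V) - prob (A j) * prob V\<bar> \<le> \<gamma> j + (if L' < j + t then c else 0)"
    if "j \<in> {L..<L'}" for j
  proof (cases "L' < j + t")
    case True
    \<comment> \<open>Without the gap, both terms lie between 0 and \<open>prob (A j)\<close>, so
      they differ by at most \<open>c\<close>.\<close>
    have "prob (A j \<inter> V) \<le> prob (A j)"
      using A by (intro finite_measure_mono) auto
    moreover have "prob (A j) * prob V \<le> prob (A j)"
      by (intro mult_left_le) auto
    moreover have "0 \<le> prob (A j \<inter> V)" "0 \<le> prob (A j) * prob V"
      by auto
    moreover have "prob (A j) \<le> c"
      using c(1)[of j] that assms(2) by simp
    ultimately show ?thesis
      using \<gamma>[of j] unfolding if_P[OF True] abs_le_iff by linarith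
  qed (use mix[of j] in simp)
  then have "(\<Sum>j\<in>{L..<L'}. \<bar>prob (A j \<inter> V) - prob (A j) * prob V\<bar>)
      \<le> (\<Sum>j\<in>{L..<L'}. \<gamma> j + (if L' < j + t then c else 0))"
    by (rule sum_mono)
  also have "\<dots> = (\<Sum>j\<in>{L..<L'}. \<gamma> j) + real (card {j \<in> {L..<L'}. L' < j + t}) * c"
    by (simp add: sum.distrib flip: sum.inter_filter)
  also have "real (card {j \<in> {L..<L'}. L' < j + t}) * c \<le> real t * c"
  proof -
    have "card {j \<in> {L..<L'}. L' < j + t} \<le> card {L' - t..<L'}"
      by (intro card_mono) auto
    then show ?thesis
      using c(2) by (intro mult_right_mono) auto
  qed
  finally have "(\<Sum>j\<in>{L..<L'}. \<bar>prob (A j \<inter> V) - prob (A j) * prob V\<bar>)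
      \<le> (\<Sum>j\<in>{L..<L'}. \<gamma> j) + real t * c"
    by simp
  then have "\<bar>(\<Sum>j\<in>{L..<L'}. prob (A j \<inter> V)) - (\<Sum>j\<in>{L..<L'}. prob (A j)) * prob V\<bar>
      \<le> (\<Sum>j\<in>{L..<L'}. \<gamma> j) + real t * c"
    using sum_abs[of "\<lambda>j. prob (A j \<inter> V) - prob (A j) * prob V" "{L..<L'}"]
    by (simp add: sum_subtractf sum_distrib_right)
  then show ?thesis
    using avoid_bonferroni[OF assms(1,2)] unfolding V_def left_diff_distrib mult_1 abs_le_iff by linarith
qed

end

section \<open>From no exceedance to avoidance\<close>

lemma event_in_events:
  assumes "space M = UNIV" and X: "\<And>i. X i \<in> borel_measurable M"
  shows "event X u q n i \<in> events"
proof -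
  have "event X u q n i
      = {x \<in> space M. u n < X i x} \<inter> (\<Inter>k\<in>{1..q}. {x \<in> space M. X (i + k) x \<le> u n})"
    using assms(1) by (auto simp: event_def)
  moreover have "{x \<in> space M. u n < X i x} \<in> events" "{x \<in> space M. X k x \<le> u n} \<in> events" for i k
    using X by measurable
  ultimately show ?thesis
    \<comment> \<open>For \<open>q = 0\<close> the intersection has an empty index set, while
      closure under finite intersections needs a nonempty one.\<close>
    using assms(1) by (cases "q = 0") auto
qed

text \<open>
  The last exceedance before time \<open>n\<close> is followed by \<open>q\<close> non-exceedances unless it is
  among the last \<open>q\<close> indices.
\<close>

lemma prob_no_exceedance_approx:
  assumes space: "space M = UNIV" and X: "\<And>i. X i \<in> borel_measurable M"
    and c: "\<And>i. i < n \<Longrightarrow> prob {x. u n < X i x} \<le> c" "0 \<le> c"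
  shows "\<bar>prob {x. \<forall>i<n. X i x \<le> u n} - prob (avoid (event X u q n) 0 n)\<bar> \<le> real q * c"
proof -
  let ?N = "{x. \<forall>i<n. X i x \<le> u n}" and ?W = "avoid (event X u q n) 0 n"
  let ?U = "\<lambda>i. {x. u n < X i x}"
  have U: "?U i \<in> events" for i
    using X borel_measurable_less[of "\<lambda>_. u n" M "X i"] by (simp add: space)
  have N: "?N \<in> events"
  proof -
    have "?N = space M - (\<Union>i<n. ?U i)"
      by (auto simp: space not_less)
    then show ?thesis
      using U by auto
  qed
  have W: "?W \<in> events"
    using avoid_in_events[OF space event_in_events[OF space X]] .
  have "?N \<subseteq> ?W"
    by (auto simp: avoid_def event_def)
  moreover have "?W \<subseteq> ?N \<union> (\<Union>i\<in>{n - q..<n}. ?U i)"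
  proof
    fix x assume x: "x \<in> ?W"
    show "x \<in> ?N \<union> (\<Union>i\<in>{n - q..<n}. ?U i)"
    proof (cases "x \<in> ?N")
      case False
      define i where "i = Max {i. i < n \<and> u n < X i x}"
      have fin: "finite {i. i < n \<and> u n < X i x}"
        by simp
      then have i: "i < n" "u n < X i x"
        using Max_in[OF fin] False by (auto simp: i_def not_le)
      have last: "X j x \<le> u n" if "i < j" "j < n" for j
        using Max_ge[OF fin, of j] that by (auto simp: i_def not_less[symmetric])
      have "\<not> i + q < n"
      proof
        assume "i + q < n"
        then have "x \<in> event X u q n i"
          using i last by (auto simp: event_def)
        then show False
          using x i(1) by (auto simp: avoid_def)
      qed
      then show ?thesis
        using i by auto
    qed simp
  qed
  then have "prob ?W \<le> prob (?N \<union> (\<Union>i\<in>{n - q..<n}. ?U i))"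
    using N U by (intro finite_measure_mono) auto
  moreover have "prob (?N \<union> (\<Union>i\<in>{n - q..<n}. ?U i)) \<le> prob ?N + prob (\<Union>i\<in>{n - q..<n}. ?U i)"
    using N U by (intro measure_Un_le) auto
  moreover have "prob (\<Union>i\<in>{n - q..<n}. ?U i) \<le> real q * c"
  proof -
    have "prob (\<Union>i\<in>{n - q..<n}. ?U i) \<le> (\<Sum>i\<in>{n - q..<n}. prob (?U i))"
      using U by (intro finite_measure_subadditive_finite) auto
    also have "\<dots> \<le> real (card {n - q..<n}) * c"
      using c(1) by (intro sum_bounded_above) auto
    also have "\<dots> \<le> real q * c"
      using c(2) by (intro mult_right_mono) auto
    finally show ?thesis .
  qed
  moreover have "prob ?N \<le> prob ?W"
    using \<open>?N \<subseteq> ?W\<close> W by (rule finite_measure_mono)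
  moreover have "0 \<le> real q * c"
    using c(2) by simp
  ultimately show ?thesis
    unfolding abs_le_iff by linarith
qed

end

section \<open>The limit for a fixed sample measure\<close>

text \<open>Equivariance enters only through the hypothesis on \<open>G\<close>, which expresses all
  tails under the single measure \<open>M\<close>.\<close>

lemma (in prob_space) no_exceedance_tendsto:
  assumes space: "space M = UNIV" and X: "\<And>i. X i \<in> borel_measurable M"
    and G: "\<And>n i. G n i = prob {x. u n < X i x}"
    and max0: "tail_max G \<longlonglongrightarrow> 0" and sum\<tau>: "tail_sum G \<longlonglongrightarrow> \<tau>"
    and D: "cond_D M X u G q \<gamma> t" and D': "cond_D' M X u G q t k"
    and ext: "extremal_index_cond M X u G q k \<theta>"
  shows "(\<lambda>n. prob {x. \<forall>i<n. X i x \<le> u n}) \<longlonglongrightarrow> exp (- \<theta> * \<tau>)"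
proof -
  define A where "A = event X u q"
  define L where "L = block_end G k"
  define p where "p n j = prob (A n j)" for n j
  \<comment> \<open>Blocks are counted from 0 here: index \<open>i\<close> is block
    \<open>i + 1\<close> of \<open>cond_D'\<close> and \<open>extremal_index_cond\<close>.\<close>
  define a where "a n i = (\<Sum>j\<in>{L n i..<L n (Suc i)}. p n j)" for n i
  define b where "b n i = (\<Sum>j\<in>{L n i..<L n (Suc i)}. G n j)" for n i
  define V where "V n i = prob (avoid (A n) (L n i) (n - L n i))" for n i
  define R where "R n = (\<Sum>i<k n. \<Sum>j\<in>{L n i..<L n (Suc i)}. \<Sum>r\<in>{Suc j..<L n (Suc i)}.
    prob (A n j \<inter> A n r))" for n
  \<comment> \<open>Total error: coincidences within blocks, mixing, and the gaps of length
    \<open>t n\<close> at the ends of \<open>k n\<close> blocks.\<close>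
  define E where "E n = R n + (\<Sum>j<n. \<gamma> j n (t n)) + real (k n) * real (t n) * tail_max G n" for n

  have k: "0 < k n" and t: "0 < t n" for n
    using D D' by (auto simp: cond_D_def cond_D'_def)
  have k_top: "filterlim k at_top sequentially"
    and kt: "(\<lambda>n. real (k n) * real (t n) * tail_max G n) \<longlonglongrightarrow> 0"
    using D' by (auto simp: cond_D'_def)
  have \<gamma>0: "(\<lambda>n. \<Sum>j<n. \<gamma> j n (t n)) \<longlonglongrightarrow> 0"
    using D by (simp add: cond_D_def)
  have mix: "\<bar>prob (A n j \<inter> avoid (A n) (j + s) l) - p n j * prob (avoid (A n) (j + s) l)\<bar> \<le> \<gamma> j n s"
    if "1 \<le> l" "1 \<le> s" "1 \<le> n" for l s n j
    using D that by (simp add: cond_D_def A_def p_def)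
  have \<gamma>_mono: "\<gamma> j n s' \<le> \<gamma> j n s" if "1 \<le> s" "s \<le> s'" "1 \<le> n" for j n s s'
  proof -
    have "antimono_on {1..} (\<gamma> j n)"
      using D that by (simp add: cond_D_def)
    then show ?thesis
      using that by (auto simp: monotone_on_def)
  qed
  \<comment> \<open>The coefficient bounds an absolute value.\<close>
  have \<gamma>_nonneg: "0 \<le> \<gamma> j n s" if "1 \<le> s" "1 \<le> n" for j n s
    using mix[of 1 s n j] that by linarith
  have A_events: "A n j \<in> events" for n j
    unfolding A_def using event_in_events[OF space X] .
  have U_events: "{x. u n < X i x} \<in> events" for n i
    using X borel_measurable_less[of "\<lambda>_. u n" M "X i"] by (simp add: space)
  have G0: "0 \<le> G n j" for n j
    by (simp add: G)
  have p_le: "p n j \<le> G n j" and p0: "0 \<le> p n j" for n j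
    unfolding p_def G using U_events by (auto intro!: finite_measure_mono simp: A_def event_def)
  have max_nonneg: "0 \<le> tail_max G n" if "0 < n" for n
    using G0[of n 0] tail_le_tail_max[OF that, of G] by linarith
  have L_le: "L n i \<le> n" for n i
    unfolding L_def by (rule block_end_le) (rule G0)
  have L_mono: "L n i \<le> L n (Suc i)" for n i
    by (simp add: L_def)
  have a0: "0 \<le> a n i" and a_le: "a n i \<le> b n i" for n i
    unfolding a_def b_def by (auto intro!: sum_nonneg sum_mono p0 p_le)
  have b_le: "b n i \<le> tail_sum G n / real (k n)" for n i
    unfolding b_def L_def
    using next_len_props(2)[of G n "block_end G k n i" k] G0 L_le[of n i] by (simp add: L_def)

  have R0: "R \<longlonglongrightarrow> 0"
  proof -
    \<comment> \<open>With absolute positions and the block index shifted by one, \<open>R\<close>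
      is the triple sum of \<open>cond_D'\<close>.\<close>
    have "R = (\<lambda>n. \<Sum>i\<in>{1..k n}. \<Sum>j<block_len G k n i. \<Sum>r\<in>{j + 1..<block_len G k n i}.
        measure M (event X u q n (block_end G k n (i - 1) + j)
                   \<inter> event X u q n (block_end G k n (i - 1) + r)))"
      unfolding One_nat_def sum.atLeast1_atMost_eq R_def fun_eq_iff
      using sum_pairs_shift[where h = "\<lambda>j r. prob (A n j \<inter> A n r)" for n]
      by (simp add: A_def L_def block_len_def)
    then show ?thesis
      using D' unfolding cond_D'_def by metis
  qed
  have E0: "E \<longlonglongrightarrow> 0"
    unfolding E_def using tendsto_add[OF tendsto_add[OF R0 \<gamma>0] kt] by simp

  \<comment> \<open>Dropping the factor \<open>t n\<close> is harmless, since it is at least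
    1.\<close>
  have kmax: "(\<lambda>n. real (k n) * tail_max G n) \<longlonglongrightarrow> 0"
  proof (rule tendsto_sandwich[OF _ _ tendsto_const kt])
    show "\<forall>\<^sub>F n in sequentially. 0 \<le> real (k n) * tail_max G n"
      using eventually_gt_at_top[of 0] by eventually_elim (simp add: max_nonneg)
    show "\<forall>\<^sub>F n in sequentially. real (k n) * tail_max G n \<le> real (k n) * real (t n) * tail_max G n"
      using eventually_gt_at_top[of 0]
    proof eventually_elim
      case (elim n)
      have "real (k n) * 1 * tail_max G n \<le> real (k n) * real (t n) * tail_max G n"
        using t[of n] max_nonneg[OF elim] by (intro mult_right_mono mult_left_mono) auto
      then show ?case by simp
    qed
  qed

  have sum_b: "(\<Sum>i<k n. b n i) = (\<Sum>j<L n (k n). G n j)" for n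
    unfolding b_def L_def by (rule sum_blocks)
  have sum_b_le: "(\<Sum>i<k n. b n i) \<le> tail_sum G n" for n
    unfolding sum_b tail_sum_def using L_le[of n "k n"] G0 by (intro sum_mono2) auto
  have sum_b_ge: "tail_sum G n - real (k n) * tail_max G n \<le> (\<Sum>i<k n. b n i)" if "0 < n" for n
    unfolding sum_b L_def using that k G0 by (intro sum_blocks_ge) auto
  have b_lim: "(\<lambda>n. \<Sum>i<k n. b n i) \<longlonglongrightarrow> \<tau>"
  proof (rule tendsto_sandwich[OF _ _ _ sum\<tau>])
    show "\<forall>\<^sub>F n in sequentially. tail_sum G n - real (k n) * tail_max G n \<le> (\<Sum>i<k n. b n i)"
      using eventually_gt_at_top[of 0] by eventually_elim (rule sum_b_ge)
    show "(\<lambda>n. tail_sum G n - real (k n) * tail_max G n) \<longlonglongrightarrow> \<tau>"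
      using tendsto_diff[OF sum\<tau> kmax] by simp
  qed (simp add: sum_b_le)

  have a_lim: "(\<lambda>n. \<Sum>i<k n. a n i) \<longlonglongrightarrow> \<theta> * \<tau>"
  proof -
    define \<epsilon> where "\<epsilon> n = (MAX i\<in>{1..k n}. \<bar>\<theta> * real (k n) * b n (i - 1) - real (k n) * a n (i - 1)\<bar>)"
      for n
    have "(MAX i\<in>{1..k n}.
        \<bar>\<theta> * real (k n) * (\<Sum>j\<in>{block_end G k n (i - 1)..<block_end G k n i}. G n j)
         - real (k n) * (\<Sum>j\<in>{block_end G k n (i - 1)..<block_end G k n i}.
                            measure M (event X u q n j))\<bar>) = \<epsilon> n" for n
      unfolding \<epsilon>_def a_def b_def L_def p_def A_def
      by (intro arg_cong[where f = Max] image_cong) (auto simp del: block_end.simps)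
    then have \<epsilon>: "\<epsilon> \<longlonglongrightarrow> 0"
      using ext by (simp add: extremal_index_cond_def)
    \<comment> \<open>The condition controls each block up to
      \<open>\<epsilon> n / real (k n)\<close>, and there are \<open>k n\<close> blocks.\<close>
    have "\<bar>(\<Sum>i<k n. a n i) - \<theta> * (\<Sum>i<k n. b n i)\<bar> \<le> \<epsilon> n" for n
    proof -
      have "\<bar>a n i - \<theta> * b n i\<bar> \<le> \<epsilon> n / real (k n)" if "i < k n" for i
      proof -
        have "\<bar>\<theta> * real (k n) * b n (Suc i - 1) - real (k n) * a n (Suc i - 1)\<bar> \<le> \<epsilon> n"
          unfolding \<epsilon>_def using that by (intro Max_ge) (auto intro!: image_eqI[of _ _ "Suc i"])
        moreover have "\<theta> * real (k n) * b n i - real (k n) * a n i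
            = - (real (k n) * (a n i - \<theta> * b n i))"
          by (simp add: algebra_simps)
        ultimately have "real (k n) * \<bar>a n i - \<theta> * b n i\<bar> \<le> \<epsilon> n"
          by (simp add: abs_mult)
        then show ?thesis
          using k[of n] by (simp add: pos_le_divide_eq mult.commute)
      qed
      then have "(\<Sum>i<k n. \<bar>a n i - \<theta> * b n i\<bar>) \<le> (\<Sum>i<k n. \<epsilon> n / real (k n))"
        by (intro sum_mono) auto
      also have "\<dots> = \<epsilon> n"
        using k[of n] by simp
      finally show ?thesis
        using sum_abs[of "\<lambda>i. a n i - \<theta> * b n i" "{..<k n}"]
        by (simp add: sum_subtractf sum_distrib_left)
    qed
    then have "(\<lambda>n. (\<Sum>i<k n. a n i) - \<theta> * (\<Sum>i<k n. b n i)) \<longlonglongrightarrow> 0"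
      by (intro Lim_null_comparison[OF _ \<epsilon>]) simp
    from tendsto_add[OF this tendsto_mult_left[OF b_lim, of \<theta>]] show ?thesis
      by simp
  qed

  \<comment> \<open>Every \<open>a n i\<close> is at most one block budget; this gives the uniform
    smallness needed for the product limit.\<close>
  have d0: "(\<lambda>n. tail_sum G n / real (k n)) \<longlonglongrightarrow> 0"
    using filterlim_compose[OF filterlim_real_sequentially k_top]
    by (intro real_tendsto_divide_at_top[OF sum\<tau>]) simp
  have a_d: "a n i \<le> tail_sum G n / real (k n)" for n i
    using a_le b_le by (rule order.trans)
  have prod_lim: "(\<lambda>n. \<Prod>i<k n. 1 - a n i) \<longlonglongrightarrow> exp (- (\<theta> * \<tau>))"
    by (rule prod_one_minus_tendsto_exp[OF _ d0 a_lim]) (simp add: a0 a_d)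

  have V_step: "\<bar>V n i - (1 - a n i) * V n (Suc i)\<bar>
      \<le> (\<Sum>j\<in>{L n i..<L n (Suc i)}. \<Sum>r\<in>{Suc j..<L n (Suc i)}. prob (A n j \<inter> A n r))
        + (\<Sum>j\<in>{L n i..<L n (Suc i)}. \<gamma> j n (t n)) + real (t n) * tail_max G n"
    if n: "1 \<le> n" for n i
    unfolding V_def a_def p_def
  proof (rule avoid_block_step[OF space A_events L_mono L_le])
    show "prob (A n j) \<le> tail_max G n" if "j < n" for j
      using p_le[of n j] tail_le_tail_max[OF that, of G] by (simp add: p_def)
    show "0 \<le> tail_max G n" "0 \<le> \<gamma> j n (t n)" for j
      using n t[of n] max_nonneg \<gamma>_nonneg by auto
    show "\<bar>prob (A n j \<inter> avoid (A n) (L n (Suc i)) (n - L n (Suc i)))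
        - prob (A n j) * prob (avoid (A n) (L n (Suc i)) (n - L n (Suc i)))\<bar> \<le> \<gamma> j n (t n)"
      if j: "j + t n \<le> L n (Suc i)" for j
    \<comment> \<open>The mixing condition needs a nonempty window. If the block ends at
      \<open>n\<close>, the avoidance set is everything and the difference is 0.\<close>
    proof (cases "L n (Suc i) = n")
      case True
      then show ?thesis
        using prob_space n t[of n] \<gamma>_nonneg[of "t n" n j] by (simp add: avoid_def space)
    next
      case False
      \<comment> \<open>The gap from \<open>j\<close> to the block end may exceed
        \<open>t n\<close>, but the coefficient decreases in the gap.\<close>
      define s where "s = L n (Suc i) - j"
      have s: "j + s = L n (Suc i)" "t n \<le> s"
        using j by (auto simp: s_def)
      have "\<bar>prob (A n j \<inter> avoid (A n) (j + s) (n - L n (Suc i)))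
          - p n j * prob (avoid (A n) (j + s) (n - L n (Suc i)))\<bar> \<le> \<gamma> j n s"
        using False L_le[of n "Suc i"] s t[of n] n by (intro mix) auto
      also have "\<gamma> j n s \<le> \<gamma> j n (t n)"
        using s t[of n] n by (intro \<gamma>_mono) auto
      finally show ?thesis
        by (simp add: s p_def)
    qed
  qed

  have telescoped: "\<bar>V n 0 - (\<Prod>i<k n. 1 - a n i) * V n (k n)\<bar> \<le> E n"
    if n: "1 \<le> n" and d: "tail_sum G n / real (k n) < 1" for n
  proof -
    have "\<bar>V n 0 - (\<Prod>i<k n. 1 - a n i) * V n (k n)\<bar>
        \<le> (\<Sum>i<k n. (\<Sum>j\<in>{L n i..<L n (Suc i)}. \<Sum>r\<in>{Suc j..<L n (Suc i)}. prob (A n j \<inter> A n r))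
          + (\<Sum>j\<in>{L n i..<L n (Suc i)}. \<gamma> j n (t n)) + real (t n) * tail_max G n)"
    proof (rule approx_recursion_prod)
      show "0 \<le> a n i \<and> a n i \<le> 1" for i
        using a0 a_d[of n i] d by auto
    qed (rule V_step[OF n])
    also have "\<dots> = R n + (\<Sum>j<L n (k n). \<gamma> j n (t n)) + real (k n) * real (t n) * tail_max G n"
      unfolding sum.distrib R_def L_def sum_blocks by (simp add: mult.assoc)
    also have "(\<Sum>j<L n (k n). \<gamma> j n (t n)) \<le> (\<Sum>j<n. \<gamma> j n (t n))"
      using L_le[of n "k n"] n t[of n] \<gamma>_nonneg by (intro sum_mono2) auto
    finally show ?thesis
      by (simp add: E_def)
  qed

  \<comment> \<open>The indices after the last block carry tail mass at most
    \<open>real (k n) * tail_max G n\<close>, so a union bound applies.\<close>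
  have V_lim: "(\<lambda>n. V n (k n)) \<longlonglongrightarrow> 1"
  proof (rule tendsto_sandwich[of "\<lambda>n. 1 - real (k n) * tail_max G n" _ _ "\<lambda>_. 1"])
    show "\<forall>\<^sub>F n in sequentially. 1 - real (k n) * tail_max G n \<le> V n (k n)"
      using eventually_gt_at_top[of 0]
    proof eventually_elim
      case (elim n)
      let ?L = "L n (k n)"
      have "(\<Sum>j\<in>{?L..<n}. p n j) \<le> (\<Sum>j\<in>{?L..<n}. G n j)"
        by (intro sum_mono p_le)
      also have "\<dots> = tail_sum G n - (\<Sum>j<?L. G n j)"
        using sum.atLeastLessThan_concat[of 0 ?L n "G n"] L_le[of n "k n"]
        by (simp add: tail_sum_def atLeast0LessThan)
      also have "\<dots> \<le> real (k n) * tail_max G n"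
        using sum_b_ge[OF elim] by (simp add: sum_b)
      finally show ?case
        using prob_avoid_ge[where A = "A n" and s = ?L and l = "n - ?L", OF space A_events] L_le[of n "k n"]
        by (simp add: V_def p_def)
    qed
    show "(\<lambda>n. 1 - real (k n) * tail_max G n) \<longlonglongrightarrow> 1"
      using tendsto_diff[OF tendsto_const kmax] by simp
  qed (simp_all add: V_def)

  have "(\<lambda>n. V n 0 - (\<Prod>i<k n. 1 - a n i) * V n (k n)) \<longlonglongrightarrow> 0"
  proof (rule Lim_null_comparison[OF _ E0])
    show "\<forall>\<^sub>F n in sequentially. norm (V n 0 - (\<Prod>i<k n. 1 - a n i) * V n (k n)) \<le> E n"
      using eventually_ge_at_top[of 1] order_tendstoD(2)[OF d0 zero_less_one]
      by eventually_elim (simp add: telescoped)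
  qed
  from tendsto_add[OF this tendsto_mult[OF prod_lim V_lim]]
  have V0_lim: "(\<lambda>n. V n 0) \<longlonglongrightarrow> exp (- (\<theta> * \<tau>))"
    by simp
  \<comment> \<open>The first block starts at 0, so \<open>V n 0\<close> concerns the full window;
    it differs from having no exceedance only through the last \<open>q\<close> indices.\<close>
  have "(\<lambda>n. prob {x. \<forall>i<n. X i x \<le> u n} - V n 0) \<longlonglongrightarrow> 0"
  proof (rule Lim_null_comparison)
    show "\<forall>\<^sub>F n in sequentially. norm (prob {x. \<forall>i<n. X i x \<le> u n} - V n 0) \<le> real q * tail_max G n"
      using eventually_gt_at_top[of 0]
    proof eventually_elim
      case (elim n)
      show ?case
        using prob_no_exceedance_approx[where X = X and u = u and n = n and q = q
            and c = "tail_max G n", OF space X]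
          max_nonneg[OF elim] tail_le_tail_max[of _ n G]
        by (simp add: V_def L_def A_def G)
    qed
    show "(\<lambda>n. real q * tail_max G n) \<longlonglongrightarrow> 0"
      using tendsto_mult_left[OF max0, of "real q"] by simp
  qed
  from tendsto_add[OF this V0_lim] show ?thesis
    by simp
qed

section \<open>Sample measures along orbits, and the almost-everywhere statement\<close>

text \<open>Since \<open>T\<close> preserves \<open>P\<close>, the exceptional null set pulls back
  to a null set under each iterate, and there are countably many iterates.\<close>

lemma (in random_system) AE_orbit:
  assumes "AE \<omega> in P. Q \<omega>"
  shows "AE \<omega> in P. \<forall>i. Q ((T ^^ i) \<omega>)"
proof -
  have "AE \<omega> in P. Q ((T ^^ i) \<omega>)" for i
  proof (induction i)
    case (Suc i)
    then have "AE \<omega> in distr P P T. Q ((T ^^ i) \<omega>)"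
      by (simp only: base_preserving)
    then have "AE \<omega> in P. Q ((T ^^ i) (T \<omega>))"
      by (rule AE_distrD[OF base_measurable])
    then show ?case
      by (simp add: funpow_swap1)
  qed (use assms in simp)
  then show ?thesis
    by (simp add: AE_all_countable)
qed

lemma (in random_system) orbit_in_space:
  "\<omega> \<in> space P \<Longrightarrow> (T ^^ i) \<omega> \<in> space P"
  by (induction i) (auto intro: measurable_space[OF base_measurable])

lemma (in random_system) fiber_iter_measurable:
  assumes "\<omega> \<in> space P"
  shows "fiber_iter T f \<omega> i \<in> borel \<rightarrow>\<^sub>M borel"
proof (induction i)
  case (Suc i)
  then show ?case
    using measurable_comp[OF Suc fiber_measurable[OF orbit_in_space[OF assms, of i]]]
    by (simp only: fiber_iter.simps)
qed (simp add: id_def)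

lemma (in random_system) sample_prob_space:
  assumes "\<omega> \<in> space P"
  shows "prob_space (\<mu> \<omega>)" and "sets (\<mu> \<omega>) = sets borel"
  using measurable_space[OF sample_kernel assms] by (auto simp: space_prob_algebra)

text \<open>Each fibre map moves the sample measure one step along the orbit. Equivariance is
  required on this orbit only, since it holds merely almost everywhere.\<close>

lemma (in random_system) distr_fiber_iter:
  assumes \<omega>: "\<omega> \<in> space P"
    and eq: "\<And>i. distr (\<mu> ((T ^^ i) \<omega>)) borel (f ((T ^^ i) \<omega>)) = \<mu> ((T ^^ Suc i) \<omega>)"
  shows "distr (\<mu> \<omega>) borel (fiber_iter T f \<omega> i) = \<mu> ((T ^^ i) \<omega>)"
proof (induction i)
  case 0
  show ?case
    using distr_id2[OF sample_prob_space(2)[OF \<omega>, symmetric]] by (simp add: id_def)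
next
  case (Suc i)
  have meas: "fiber_iter T f \<omega> i \<in> \<mu> \<omega> \<rightarrow>\<^sub>M borel"
    using fiber_iter_measurable[OF \<omega>] measurable_cong_sets[OF sample_prob_space(2)[OF \<omega>] refl]
    by blast
  have "distr (\<mu> \<omega>) borel (fiber_iter T f \<omega> (Suc i))
      = distr (distr (\<mu> \<omega>) borel (fiber_iter T f \<omega> i)) borel (f ((T ^^ i) \<omega>))"
    using distr_distr[OF fiber_measurable[OF orbit_in_space[OF \<omega>]] meas] by simp
  also have "\<dots> = \<mu> ((T ^^ Suc i) \<omega>)"
    unfolding Suc by (rule eq)
  finally show ?case .
qed

theorem corollary5p1:
  fixes P :: "'w measure"
    and T :: "'w \<Rightarrow> 'w"
    and f :: "'w \<Rightarrow> 'x::metric_space \<Rightarrow> 'x"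
    and \<mu>t :: "('x \<times> 'w) measure"
    and \<mu> :: "'w \<Rightarrow> 'x measure"
    and g :: "real \<Rightarrow> ereal"
    and \<zeta> :: 'x
    and \<phi> :: "'x \<Rightarrow> ereal"
    and X :: "'w \<Rightarrow> nat \<Rightarrow> 'x \<Rightarrow> ereal"
    and u :: "nat \<Rightarrow> ereal"
    and G :: "'w \<Rightarrow> nat \<Rightarrow> nat \<Rightarrow> real"
    and \<tau> \<theta> :: real
    and q :: nat
  assumes system: "random_system P T f \<mu>t \<mu>"
    and profile: "admissible_profile g"
    and phi: "\<phi> = obs g \<zeta>"
    and phi_measurable: "\<phi> \<in> borel_measurable borel"
    and X: "X = process T f \<phi>"
    and tau: "\<tau> > 0"
    and u: "u = level P \<mu> \<phi> \<tau>"
    and G: "G = tail T \<mu> \<phi> u"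
    and endpoint: "AE \<omega> in P. \<forall>i.
          (dist_fun T \<mu> \<phi> \<omega> i \<longlongrightarrow> 1) (at_left (right_endpoint (dist_fun T \<mu> \<phi> \<omega> i)))"
    and tails: "AE \<omega> in P. tail_max (G \<omega>) \<longlonglongrightarrow> 0 \<and> tail_sum (G \<omega>) \<longlonglongrightarrow> \<tau>"
    and q_min: "AE \<omega> in P. returns_diverge (X \<omega>) u q \<and>
          (\<forall>j. returns_diverge (X \<omega>) u j \<longrightarrow> q \<le> j)"
    and theta: "0 \<le> \<theta>" "\<theta> \<le> 1"
    and conditions: "AE \<omega> in P. \<exists>\<gamma> t k.
          cond_D (\<mu> \<omega>) (X \<omega>) u (G \<omega>) q \<gamma> t \<and>
          cond_D' (\<mu> \<omega>) (X \<omega>) u (G \<omega>) q t k \<and>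
          extremal_index_cond (\<mu> \<omega>) (X \<omega>) u (G \<omega>) q k \<theta>"
  shows "AE \<omega> in P.
      (\<lambda>n. measure (\<mu> \<omega>) {x. (MAX i\<in>{..<n}. X \<omega> i x) \<le> u n}) \<longlonglongrightarrow> exp (- \<theta> * \<tau>)"
proof -
  interpret random_system P T f \<mu>t \<mu>
    by (rule system)
  from AE_orbit[OF sample_equivariant] tails conditions AE_space show ?thesis
  proof eventually_elim
    case (elim \<omega>)
    then obtain \<gamma> t k where
      conds: "cond_D (\<mu> \<omega>) (X \<omega>) u (G \<omega>) q \<gamma> t" "cond_D' (\<mu> \<omega>) (X \<omega>) u (G \<omega>) q t k"
        "extremal_index_cond (\<mu> \<omega>) (X \<omega>) u (G \<omega>) q k \<theta>"
      by blast
    have \<omega>: "\<omega> \<in> space P"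
      using elim by blast
    note sets = sample_prob_space(2)
    interpret m: prob_space "\<mu> \<omega>"
      by (rule sample_prob_space(1)[OF \<omega>])
    have iter: "fiber_iter T f \<omega> i \<in> \<mu> \<omega> \<rightarrow>\<^sub>M borel" for i
      using fiber_iter_measurable[OF \<omega>] measurable_cong_sets[OF sets[OF \<omega>] refl] by blast
    have X_meas: "X \<omega> i \<in> borel_measurable (\<mu> \<omega>)" for i
      unfolding X process_def using iter phi_measurable by (rule measurable_comp)
    have space: "space (\<mu> \<omega>) = UNIV"
      using sets_eq_imp_space_eq[OF sets[OF \<omega>]] by simp
    \<comment> \<open>\<open>dist_fun\<close> uses the sample measure at the \<open>i\<close>-th
      orbit point; this is an image of \<open>\<mu> \<omega>\<close>, so the tail becomes a
      probability under \<open>\<mu> \<omega>\<close>.\<close>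
    have tail: "G \<omega> n i = m.prob {x. u n < X \<omega> i x}" for n i
    proof -
      have le: "{x. \<phi> x \<le> u n} \<in> sets borel"
        using borel_measurable_le[OF phi_measurable, of "\<lambda>_. u n"] by simp
      have "dist_fun T \<mu> \<phi> \<omega> i (u n)
          = measure (distr (\<mu> \<omega>) borel (fiber_iter T f \<omega> i)) {x. \<phi> x \<le> u n}"
        using distr_fiber_iter[OF \<omega>, of i] elim(1) by (simp add: dist_fun_def)
      also have "\<dots> = m.prob {x. X \<omega> i x \<le> u n}"
        by (simp add: measure_distr[OF iter le] space X process_def vimage_def)
      finally have "G \<omega> n i = 1 - m.prob {x. X \<omega> i x \<le> u n}"
        by (simp add: G tail_def)
      also have "\<dots> = m.prob (space (\<mu> \<omega>) - {x. X \<omega> i x \<le> u n})"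
        using borel_measurable_le[OF X_meas, of "\<lambda>_. u n"]
        by (intro m.prob_compl[symmetric]) (simp add: space)
      also have "space (\<mu> \<omega>) - {x. X \<omega> i x \<le> u n} = {x. u n < X \<omega> i x}"
        by (auto simp: space)
      finally show ?thesis .
    qed
    have "(\<lambda>n. m.prob {x. \<forall>i<n. X \<omega> i x \<le> u n}) \<longlonglongrightarrow> exp (- \<theta> * \<tau>)"
      using elim(2) by (intro m.no_exceedance_tendsto[OF space X_meas tail _ _ conds]) auto
    \<comment> \<open>At \<open>n = 0\<close> the \<open>MAX\<close> is over an empty set and
      unspecified, so the events are compared only eventually.\<close>
    moreover have "\<forall>\<^sub>F n in sequentially. m.prob {x. \<forall>i<n. X \<omega> i x \<le> u n}
        = m.prob {x. (MAX i\<in>{..<n}. X \<omega> i x) \<le> u n}"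
      using eventually_gt_at_top[of 0] 
    proof eventually_elim
      case (elim n)
      then have "(\<forall>i<n. X \<omega> i x \<le> u n) \<longleftrightarrow> (MAX i\<in>{..<n}. X \<omega> i x) \<le> u n" for x
        by (subst Max_le_iff) auto
      then show ?case
        by simp
    qed
    ultimately show ?case
      by (rule Lim_transform_eventually)
  qed
qed

end
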